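(* Let $F_{a,w}=\langle a,w\rangle$ be the free group on two letters, let $r$ be a word in $F_{a,w}$, and let $\overleftarrow{r}$ be the word obtained from $r$ by writing its letters in reversed order. Then the universal character ring of the group $G=\langle a,w \mid r=\overleftarrow{r}\rangle$ is the quotient of the polynomial ring $\mathbb{C}[x,y,z]$ by the principal ideal generated by the polynomial $P_{raw}-P_{\overleftarrow{r}aw}$.
   Context: Words are in the letters $a^{\pm1},w^{\pm1}$; juxtaposition (as in $raw$) is the product in $F_{a,w}$. Reversal $u\mapsto\overleftarrow{u}$ writes the letters in reversed order, keeping each letter (with its exponent) unchanged, e.g. $\overleftarrow{awa^{-1}}=a^{-1}wa$; it is well defined on $F_{a,w}$ as the anti-automorphism fixing $a$ and $w$. Trace polynomials: for every $u\in F_{a,w}$ there is a unique polynomial $P_u\in\mathbb{C}[x,y,z]$ such that for every representation $\rho:F_{a,w}\to SL_2(\mathbb{C})$ one has $\operatorname{tr}\rho(u)=P_u(\operatorname{tr}\rho(a),\operatorname{tr}\rho(w),\operatorname{tr}\rho(aw))$. Thus $x=P_a$, $y=P_w$, $z=P_{aw}$. Universal character ring: for a finitely presented group $G$, choose $g_1,\dots,g_k\in G$ such that for every $g\in G$ there is a polynomial $P_g$ in $k$ variables with $\operatorname{tr}\rho(g)=P_g(x_1,\dots,x_k)$, $x_j=\operatorname{tr}\rho(g_j)$, for all representations $\rho:G\to SL_2(\mathbb{C})$; the universal character ring is the quotient of $\mathbb{C}[x_1,\dots,x_k]$ by the ideal generated by all expressions $\operatorname{tr}\rho(u)-\operatorname{tr}\rho(v)$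 where $u,v$ are words in $g_1,\dots,g_k$ which are equal in $G$. It does not depend on the choice of the $g_j$. For a group $G$ generated by two elements $a,w$ (a quotient of $F_{a,w}$), using $a,w,aw$, this is concretely $\mathbb{C}[x,y,z]/J$, where $J$ is the ideal generated by all $P_u-P_v$ with $u,v\in F_{a,w}$ having the same image in $G$. *)

theory Defs
  imports
    "HOL-Analysis.Analysis"
    "HOL-Computational_Algebra.Polynomial"
    "HOL-Algebra.Algebra"
begin

section \<open>The free group on two letters\<close>

datatype gen = GenA | GenW

text \<open>The letter \<open>(g, True)\<close> stands for \<open>g\<close> and \<open>(g, False)\<close> for its inverse; thus the
  reversal of words that keeps every letter together with its exponent is
  \<^const>\<open>rev\<close>, not the inverse of the word. Words need not be reduced.\<close>

type_synonym word = "(gen \<times> bool) list"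

inductive free_eq :: "word \<Rightarrow> word \<Rightarrow> bool" where
  refl: "free_eq u u"
| sym: "free_eq u v \<Longrightarrow> free_eq v u"
| trans: "free_eq u v \<Longrightarrow> free_eq v t \<Longrightarrow> free_eq u t"
| cancel: "free_eq (u @ [(g, e), (g, \<not> e)] @ v) (u @ v)"

definition word_class :: "word \<Rightarrow> word set" where
  "word_class u = {v. free_eq u v}"

definition free_group :: "word set monoid" where
  "free_group = \<lparr>carrier = range word_class,
     monoid.mult = (\<lambda>S T. \<Union>x\<in>S. \<Union>y\<in>T. word_class (x @ y)),
     one = word_class []\<rparr>"

definition gen_a :: "word set" where "gen_a = word_class [(GenA, True)]"
definition gen_w :: "word set" where "gen_w = word_class [(GenW, True)]"

lemma free_eq_append_left: "free_eq u v \<Longrightarrow> free_eq (t @ u) (t @ v)"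
proof (induction rule: free_eq.induct)
  case (cancel u g e v)
  show ?case using free_eq.cancel[of "t @ u" g e v] by simp
qed (blast intro: free_eq.intros)+

lemma free_eq_append_right: "free_eq u v \<Longrightarrow> free_eq (u @ t) (v @ t)"
proof (induction rule: free_eq.induct)
  case (cancel u g e v)
  show ?case using free_eq.cancel[of u g e "v @ t"] by simp
qed (blast intro: free_eq.intros)+

lemma free_eq_append: "free_eq u u' \<Longrightarrow> free_eq v v' \<Longrightarrow> free_eq (u @ v) (u' @ v')"
  by (blast intro: free_eq.trans free_eq_append_left free_eq_append_right)

lemma free_eq_rev: "free_eq u v \<Longrightarrow> free_eq (rev u) (rev v)"
proof (induction rule: free_eq.induct)
  case (cancel u g e v)
  show ?case using free_eq.cancel[of "rev v" g "\<not> e" "rev u"] by simp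
qed (blast intro: free_eq.intros)+

lemma word_class_eq_iff: "word_class u = word_class v \<longleftrightarrow> free_eq u v"
  unfolding word_class_def by (auto intro: free_eq.intros)

lemma mult_word_class:
  "word_class u \<otimes>\<^bsub>free_group\<^esub> word_class v = word_class (u @ v)"
proof -
  have "word_class (x @ y) = word_class (u @ v)"
    if "x \<in> word_class u" "y \<in> word_class v" for x y
    using that unfolding word_class_eq_iff
    by (simp add: word_class_def free_eq_append free_eq.sym)
  moreover have "u \<in> word_class u" "v \<in> word_class v"
    by (simp_all add: word_class_def free_eq.refl)
  ultimately have "(\<Union>x\<in>word_class u. \<Union>y\<in>word_class v. word_class (x @ y)) = word_class (u @ v)"
    by (metis (no_types, lifting) SUP_eq_const empty_iff)
  then show ?thesis by (simp add: free_group_def)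
qed

lemma free_eq_left_inverse: "free_eq (rev (map (\<lambda>(g, e). (g, \<not> e)) u) @ u) []"
proof (induction u)
  case Nil
  show ?case by (simp add: free_eq.refl)
next
  case (Cons l u)
  obtain g e where l: "l = (g, e)" by force
  have "free_eq (rev (map (\<lambda>(g, e). (g, \<not> e)) (l # u)) @ l # u)
          (rev (map (\<lambda>(g, e). (g, \<not> e)) u) @ u)"
    using free_eq.cancel[of "rev (map (\<lambda>(g, e). (g, \<not> e)) u)" g "\<not> e" u] by (simp add: l)
  then show ?case using Cons.IH by (blast intro: free_eq.trans)
qed

lemma carrier_free_group: "carrier free_group = range word_class"
  by (simp add: free_group_def)

lemma one_free_group: "\<one>\<^bsub>free_group\<^esub> = word_class []"
  by (simp add: free_group_def)

lemma group_free_group: "group free_group"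
proof (rule groupI)
  fix S assume "S \<in> carrier free_group"
  then obtain u where u: "S = word_class u" by (auto simp: carrier_free_group)
  have "word_class (rev (map (\<lambda>(g, e). (g, \<not> e)) u)) \<otimes>\<^bsub>free_group\<^esub> S = \<one>\<^bsub>free_group\<^esub>"
    using free_eq_left_inverse by (simp add: u mult_word_class one_free_group word_class_eq_iff)
  then show "\<exists>T\<in>carrier free_group. T \<otimes>\<^bsub>free_group\<^esub> S = \<one>\<^bsub>free_group\<^esub>"
    unfolding carrier_free_group by blast
next
  fix S T U
  assume "S \<in> carrier free_group" "T \<in> carrier free_group" "U \<in> carrier free_group"
  then obtain u v t where "S = word_class u" "T = word_class v" "U = word_class t"
    unfolding carrier_free_group by blast
  then show "S \<otimes>\<^bsub>free_group\<^esub> T \<otimes>\<^bsub>free_group\<^esub> U = S \<otimes>\<^bsub>free_group\<^esub> (T \<otimes>\<^bsub>free_group\<^esub> U)"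
    by (simp add: mult_word_class)
qed (auto simp: carrier_free_group one_free_group mult_word_class)

section \<open>Groups presented on the letters a and w\<close>

text \<open>A relation \<open>l = t\<close> between elements of the free group is the pair \<open>(l, t)\<close>.\<close>

definition relation_closure :: "(word set \<times> word set) set \<Rightarrow> word set set" where
  "relation_closure E =
     \<Inter> {N. N \<lhd> free_group \<and> (\<forall>(l, t)\<in>E. l \<otimes>\<^bsub>free_group\<^esub> inv\<^bsub>free_group\<^esub> t \<in> N)}"

definition presented_group :: "(word set \<times> word set) set \<Rightarrow> word set set monoid" where
  "presented_group E = free_group Mod relation_closure E"

definition presentation_map :: "(word set \<times> word set) set \<Rightarrow> word set \<Rightarrow> word set set" where
  "presentation_map E u = relation_closure E #>\<^bsub>free_group\<^esub> u"

lemma normal_relation_closure: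
  assumes "E \<subseteq> carrier free_group \<times> carrier free_group"
  shows "relation_closure E \<lhd> free_group"
proof -
  interpret F: group free_group by (rule group_free_group)
  define \<N> where "\<N> = {N. N \<lhd> free_group \<and>
    (\<forall>(l, t)\<in>E. l \<otimes>\<^bsub>free_group\<^esub> inv\<^bsub>free_group\<^esub> t \<in> N)}"
  have norm: "\<And>N. N \<in> \<N> \<Longrightarrow> N \<lhd> free_group" by (simp add: \<N>_def)
  have "carrier free_group \<lhd> free_group"
    by (auto simp: F.normal_inv_iff F.subgroup_self)
  then have "carrier free_group \<in> \<N>"
    using assms by (auto simp: \<N>_def)
  then have ne: "\<N> \<noteq> {}" by blast
  have "subgroup (\<Inter>\<N>) free_group"
    using ne norm by (intro F.subgroups_Inter) (auto simp: F.normal_inv_iff)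
  moreover have "x \<otimes>\<^bsub>free_group\<^esub> h \<otimes>\<^bsub>free_group\<^esub> inv\<^bsub>free_group\<^esub> x \<in> \<Inter>\<N>"
    if "x \<in> carrier free_group" "h \<in> \<Inter>\<N>" for x h
    using that norm by (auto simp: F.normal_inv_iff)
  ultimately show ?thesis
    unfolding relation_closure_def \<N>_def[symmetric] by (simp add: F.normal_inv_iff)
qed

lemma presentation_map_epi:
  assumes "E \<subseteq> carrier free_group \<times> carrier free_group"
  shows "presentation_map E \<in> epi free_group (presented_group E)"
proof -
  interpret N: normal "relation_closure E" free_group
    by (rule normal_relation_closure[OF assms])
  have "presentation_map E = (\<lambda>u. relation_closure E #>\<^bsub>free_group\<^esub> u)"
    by (simp add: fun_eq_iff presentation_map_def)
  then show ?thesis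
    using N.r_coset_hom_Mod by (simp add: epi_def presented_group_def carrier_FactGroup)
qed

section \<open>Trace polynomials\<close>

definition SL2C :: "(complex ^ 2 ^ 2) monoid" where
  "SL2C = \<lparr>carrier = {A. det A = 1}, monoid.mult = (**), one = mat 1\<rparr>"

text \<open>The ring \<open>\<complex>[x,y,z]\<close> is \<open>\<complex>[x][y][z]\<close>: the innermost variable is \<open>x\<close>, the outermost one
  is \<open>z\<close>.\<close>

type_synonym poly3 = "complex poly poly poly"

definition eval3 :: "poly3 \<Rightarrow> complex \<Rightarrow> complex \<Rightarrow> complex \<Rightarrow> complex" where
  "eval3 p x y z = poly (poly (poly p [:[:z:]:]) [:y:]) x"

definition poly3_ring :: "poly3 ring" where
  "poly3_ring = \<lparr>carrier = UNIV, monoid.mult = (*), one = 1, ring.zero = 0, add = (+)\<rparr>"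

lemma cring_poly3_ring: "cring poly3_ring"
proof -
  have "\<exists>q. p + q = 0" for p :: poly3
    using add.right_inverse by blast
  then show ?thesis
    unfolding poly3_ring_def
    by unfold_locales (auto simp: algebra_simps Units_def)
qed

lemma eval3_variables:
  "eval3 [:[:[:0, 1:]:]:] x y z = x"
  "eval3 [:[:0, 1:]:] x y z = y"
  "eval3 [:0, 1:] x y z = z"
  by (simp_all add: eval3_def)

definition trace_poly :: "word set \<Rightarrow> poly3" where
  "trace_poly u = (THE p. \<forall>\<rho> \<in> hom free_group SL2C.
     trace (\<rho> u) =
       eval3 p (trace (\<rho> gen_a)) (trace (\<rho> gen_w)) (trace (\<rho> (gen_a \<otimes>\<^bsub>free_group\<^esub> gen_w))))"

section \<open>The universal character ring\<close>

text \<open>A group generated by two elements is given by a surjective homomorphism \<open>\<pi>\<close> from the free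
  group on \<open>a\<close> and \<open>w\<close>; its universal character ring is formed with the generators \<open>a\<close>, \<open>w\<close>,
  \<open>aw\<close>.\<close>

definition universal_character_ideal :: "(word set \<Rightarrow> 'g) \<Rightarrow> poly3 set" where
  "universal_character_ideal \<pi> = Idl\<^bsub>poly3_ring\<^esub>
     {trace_poly u - trace_poly v | u v.
        u \<in> carrier free_group \<and> v \<in> carrier free_group \<and> \<pi> u = \<pi> v}"

definition universal_character_ring :: "(word set \<Rightarrow> 'g) \<Rightarrow> poly3 set ring" where
  "universal_character_ring \<pi> = poly3_ring Quot universal_character_ideal \<pi>"

end

theory Submission
  imports Defs
begin

text \<open>By Cayley--Hamilton every word is a combination \<open>\<alpha> + \<beta> A + \<gamma> W + \<delta> AW\<close> with coefficients in
  \<open>\<complex>[x,y,z]\<close>, and reversal replaces \<open>AW\<close> by \<open>WA\<close>; hence \<open>r - rev r = \<delta>(r) K\<close> with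
  \<open>K = AW - WA\<close>. Since \<open>K\<close>, \<open>AK\<close> and \<open>WK\<close> have trace \<open>0\<close>, the trace of \<open>v(r - rev r)\<close> is
  \<open>\<delta>(v) \<delta>(r) tr(AWK)\<close>, which is \<open>\<delta>(v)\<close> times the generator \<open>d = P\<^bsub>raw\<^esub> - P\<^bsub>(rev r)aw\<^esub>\<close>. The
  elements \<open>u\<close> with \<open>P\<^bsub>vu\<^esub> \<equiv> P\<^bsub>v\<^esub>\<close> modulo \<open>d\<close> for all \<open>v\<close> form a normal subgroup, because traces are
  invariant under cyclic permutation, so it contains the normal closure of the relation.\<close>

section \<open>Evaluation of polynomials in three variables\<close>

lemma eval3_simps [simp]:
  "eval3 0 x y z = 0" "eval3 1 x y z = 1"
  "eval3 (p + q) x y z = eval3 p x y z + eval3 q x y z"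
  "eval3 (p - q) x y z = eval3 p x y z - eval3 q x y z"
  "eval3 (- p) x y z = - eval3 p x y z"
  "eval3 (p * q) x y z = eval3 p x y z * eval3 q x y z"
  by (simp_all add: eval3_def)

text \<open>A nonzero polynomial over a domain has finitely many roots, so it cannot vanish on an
  infinite range. Later \<open>f\<close> embeds the complex numbers as constant polynomials.\<close>

lemma poly_nonzero_at_const:
  fixes p :: "'a::idom poly"
  assumes "p \<noteq> 0" "infinite (range f)"
  obtains c where "poly p (f c) \<noteq> 0"
  using poly_roots_finite[OF assms(1)] assms(2) finite_subset[of "range f" "{x. poly p x = 0}"]
  by blast

text \<open>Variables are specialised from the outside in, \<open>z\<close> before \<open>y\<close>
  before \<open>x\<close>, each at a value that keeps the difference nonzero.\<close>

lemma eval3_eqI: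
  assumes "\<And>x y z. eval3 p x y z = eval3 q x y z"
  shows "p = q"
proof (rule ccontr)
  have inf: "infinite (range (\<lambda>z::complex. [:[:z:]:]))" "infinite (range (\<lambda>y::complex. [:y:]))"
    by (auto simp: inj_def finite_image_iff infinite_UNIV_char_0)
  assume "p \<noteq> q"
  then have "p - q \<noteq> 0" by simp
  then obtain z where "poly (p - q) [:[:z:]:] \<noteq> 0"
    using inf(1) by (rule poly_nonzero_at_const)
  then obtain y where "poly (poly (p - q) [:[:z:]:]) [:y:] \<noteq> 0"
    using inf(2) by (rule poly_nonzero_at_const)
  then obtain x where "poly (poly (poly (p - q) [:[:z:]:]) [:y:]) x \<noteq> 0"
    using poly_all_0_iff_0 by blast
  then show False
    using assms[of x y z] by (simp add: eval3_def)
qed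

section \<open>Representations of the free group\<close>

lemmas matrix2_simps = vec_eq_iff forall_2 sum_2 matrix_matrix_mult_def mat_def det_2 trace_def
  transpose_def

text \<open>\<open>mat (trace M) - M\<close> is the adjugate of a 2 by 2 matrix, hence the inverse
  when the determinant is 1.\<close>

lemma adjugate2:
  fixes M :: "'a::comm_ring_1 ^ 2 ^ 2"
  shows "M ** (mat (trace M) - M) = mat (det M)"
    and "(mat (trace M) - M) ** M = mat (det M)"
    and "det (mat (trace M) - M) = det M"
  by (simp_all add: matrix2_simps algebra_simps)

fun letter_matrix :: "complex^2^2 \<Rightarrow> complex^2^2 \<Rightarrow> gen \<times> bool \<Rightarrow> complex^2^2" where
  "letter_matrix A W (g, e) =
     (let M = (case g of GenA \<Rightarrow> A | GenW \<Rightarrow> W) in if e then M else mat (trace M) - M)"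

primrec word_matrix :: "complex^2^2 \<Rightarrow> complex^2^2 \<Rightarrow> word \<Rightarrow> complex^2^2" where
  "word_matrix A W [] = mat 1"
| "word_matrix A W (l # u) = letter_matrix A W l ** word_matrix A W u"

lemma word_matrix_append: "word_matrix A W (u @ v) = word_matrix A W u ** word_matrix A W v"
  by (induction u) (simp_all add: matrix_mul_assoc)

lemma word_matrix_transpose:
  "word_matrix (transpose A) (transpose W) (rev u) = transpose (word_matrix A W u)"
proof (induction u)
  case Nil
  show ?case by (simp add: transpose_mat)
next
  case (Cons l u)
  have "letter_matrix (transpose A) (transpose W) l = transpose (letter_matrix A W l)"
    by (cases l) (auto simp: Let_def matrix2_simps split: gen.splits)
  with Cons show ?case by (simp add: word_matrix_append matrix_transpose_mul)
qed

lemma det_word_matrix: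
  assumes "det A = 1" "det W = 1"
  shows "det (word_matrix A W u) = 1"
proof (induction u)
  case (Cons l u)
  have "det (letter_matrix A W l) = 1"
    using assms by (cases l) (auto simp: Let_def adjugate2 split: gen.splits)
  with Cons show ?case by (simp add: det_mul)
qed simp

lemma word_matrix_free_eq:
  assumes "free_eq u v" "det A = 1" "det W = 1"
  shows "word_matrix A W u = word_matrix A W v"
  using assms(1)
proof induction
  case (cancel u g e v)
  have "letter_matrix A W (g, e) ** letter_matrix A W (g, \<not> e) = mat 1"
    using assms(2,3) by (auto simp: Let_def adjugate2 split: gen.splits)
  then show ?case by (simp add: word_matrix_append matrix_mul_assoc)
qed simp_all

definition rep :: "complex^2^2 \<Rightarrow> complex^2^2 \<Rightarrow> word set \<Rightarrow> complex^2^2" where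
  "rep A W S = word_matrix A W (SOME u. u \<in> S)"

lemma rep_word_class:
  assumes "det A = 1" "det W = 1"
  shows "rep A W (word_class u) = word_matrix A W u"
proof -
  have "u \<in> word_class u" by (simp add: word_class_def free_eq.refl)
  then have "(SOME v. v \<in> word_class u) \<in> word_class u" by (rule someI)
  then show ?thesis
    using word_matrix_free_eq[OF _ assms] by (simp add: rep_def word_class_def)
qed

lemma rep_hom:
  assumes "det A = 1" "det W = 1"
  shows "rep A W \<in> hom free_group SL2C"
  using assms
  by (auto simp: hom_def carrier_free_group SL2C_def rep_word_class det_word_matrix
      mult_word_class word_matrix_append)

text \<open>A representation is determined by the images of the generators: an inverse letter must
  go to the inverse matrix, which is the adjugate.\<close>

lemma hom_free_group_SL2C:
  assumes "\<rho> \<in> hom free_group SL2C"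
  shows "det (\<rho> gen_a) = 1" "det (\<rho> gen_w) = 1"
    and "\<rho> (word_class u) = word_matrix (\<rho> gen_a) (\<rho> gen_w) u"
proof -
  have mult: "\<rho> (word_class (u @ v)) = \<rho> (word_class u) ** \<rho> (word_class v)" for u v
    using assms by (auto simp: hom_def carrier_free_group SL2C_def mult_word_class[symmetric])
  have det: "det (\<rho> (word_class u)) = 1" for u
    using assms by (auto simp: hom_def carrier_free_group SL2C_def)
  from det show "det (\<rho> gen_a) = 1" "det (\<rho> gen_w) = 1"
    by (simp_all add: gen_a_def gen_w_def)
  have cancel_left: "N = (mat (trace M) - M) ** L" if "M ** N = L" "det M = 1" for M N L :: "complex^2^2"
    using that adjugate2(2)[of M] by (metis matrix_mul_assoc matrix_mul_lid)
  \<comment> \<open>\<open>hom\<close> only demands multiplicativity; the image of the empty word is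
    idempotent and invertible, hence the identity.\<close>
  have nil: "\<rho> (word_class []) = mat 1"
    using cancel_left[OF mult[of "[]" "[]", symmetric] det]
    by (simp add: adjugate2 det)
  have inv: "\<rho> (word_class [(g, False)]) = mat (trace (\<rho> (word_class [(g, True)]))) - \<rho> (word_class [(g, True)])"
    for g
  proof -
    have "\<rho> (word_class [(g, True)]) ** \<rho> (word_class [(g, False)]) = mat 1"
      using free_eq.cancel[of "[]" g True "[]"] mult[of "[(g, True)]" "[(g, False)]"]
      by (simp add: word_class_eq_iff[symmetric] nil)
    from cancel_left[OF this det] show ?thesis by simp
  qed
  have letter: "\<rho> (word_class [l]) = letter_matrix (\<rho> gen_a) (\<rho> gen_w) l" for l
    by (cases l) (auto simp: Let_def gen_a_def gen_w_def inv split: gen.splits)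
  show "\<rho> (word_class u) = word_matrix (\<rho> gen_a) (\<rho> gen_w) u"
  proof (induction u)
    case (Cons l u)
    then show ?case using mult[of "[l]" u] by (simp add: letter)
  qed (simp add: nil)
qed

text \<open>Every point of complex 3-space is a triple of traces. This makes trace polynomials
  unique and lets polynomial identities be checked on matrices.\<close>

lemma SL2_with_traces:
  obtains A W :: "complex^2^2"
  where "det A = 1" "det W = 1" "trace A = x" "trace W = y" "trace (A ** W) = z"
proof -
  \<comment> \<open>A root of \<open>s^2 - z * s + 1\<close>: the product of the two matrices below
    has diagonal \<open>z - s\<close>, \<open>s\<close>, and \<open>?W\<close> has determinant
    \<open>s * (z - s)\<close>.\<close>
  define s where "s = (z + csqrt (z^2 - 4)) / 2"
  have "2 * s - z = csqrt (z^2 - 4)" by (simp add: s_def field_simps)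
  then have "(2 * s - z)^2 = z^2 - 4" by simp
  then have "4 * (s * (z - s)) = 4 * 1"
    by (simp add: power2_eq_square algebra_simps)
  then have s: "s * (z - s) = 1"
    by (simp only: mult_cancel_left) simp
  show thesis
  proof (rule that)
    let ?A = "vector [vector [x, -1], vector [1, 0]] :: complex^2^2"
    let ?W = "vector [vector [0, s], vector [s - z, y]] :: complex^2^2"
    show "det ?A = 1" "trace ?A = x" "trace ?W = y" "trace (?A ** ?W) = z"
      by (simp_all add: matrix2_simps vector_2)
    show "det ?W = 1"
      using s by (simp add: det_2 vector_2 algebra_simps)
  qed
qed

section \<open>Words as combinations of 1, A, W, AW\<close>

definition X3 :: poly3 where "X3 = [:[:[:0, 1:]:]:]"
definition Y3 :: poly3 where "Y3 = [:[:0, 1:]:]"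
definition Z3 :: poly3 where "Z3 = [:0, 1:]"

lemma eval3_XYZ [simp]: "eval3 X3 x y z = x" "eval3 Y3 x y z = y" "eval3 Z3 x y z = z"
  by (simp_all add: X3_def Y3_def Z3_def eval3_variables)

text \<open>Left multiplication by a letter in coordinates with respect to \<open>1, A, W, AW\<close>. By
  Cayley--Hamilton \<open>A\<^sup>2 = xA - 1\<close> and \<open>W\<^sup>2 = yW - 1\<close>, and
  \<open>WA = z - xy + yA + xW - AW\<close> because \<open>(AW)\<^sup>-\<^sup>1 = z - AW\<close>.\<close>

fun letter_action ::
    "gen \<times> bool \<Rightarrow> poly3 \<times> poly3 \<times> poly3 \<times> poly3 \<Rightarrow> poly3 \<times> poly3 \<times> poly3 \<times> poly3" where
  "letter_action (GenA, True) (a, b, c, d) = (- b, a + X3 * b, - d, c + X3 * d)"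
| "letter_action (GenA, False) (a, b, c, d) = (X3 * a + b, - a, X3 * c + d, - c)"
| "letter_action (GenW, True) (a, b, c, d) =
     ((Z3 - X3 * Y3) * b - c - X3 * d, Y3 * b + d, a + X3 * b + Y3 * c + Z3 * d, - b)"
| "letter_action (GenW, False) (a, b, c, d) =
     (Y3 * a - ((Z3 - X3 * Y3) * b - c - X3 * d), - d, - a - X3 * b - Z3 * d, Y3 * d + b)"

primrec word_coords :: "word \<Rightarrow> poly3 \<times> poly3 \<times> poly3 \<times> poly3" where
  "word_coords [] = (1, 0, 0, 0)"
| "word_coords (l # u) = letter_action l (word_coords u)"

definition span_matrix ::
    "complex^2^2 \<Rightarrow> complex^2^2 \<Rightarrow> complex \<Rightarrow> complex \<Rightarrow> complex \<Rightarrow> complex \<Rightarrow> complex^2^2" where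
  "span_matrix A W a b c d = mat a + mat b ** A + mat c ** W + mat d ** (A ** W)"

lemma mult_span_matrix:
  assumes "det A = 1" "det W = 1"
  defines "x \<equiv> trace A" and "y \<equiv> trace W" and "z \<equiv> trace (A ** W)"
  shows "A ** span_matrix A W a b c d = span_matrix A W (- b) (a + x * b) (- d) (c + x * d)"
    and "W ** span_matrix A W a b c d =
      span_matrix A W ((z - x * y) * b - c - x * d) (y * b + d) (a + x * b + y * c + z * d) (- b)"
proof -
  \<comment> \<open>With \<open>det A\<close> kept symbolic this is a polynomial identity in the
    matrix entries, so expansion proves it; the determinant is set to 1 afterwards.\<close>
  have "A ** span_matrix A W a b c d =
      span_matrix A W (- (det A * b)) (a + x * b) (- (det A * d)) (c + x * d)"
    by (simp add: x_def span_matrix_def matrix2_simps algebra_simps)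
  then show "A ** span_matrix A W a b c d = span_matrix A W (- b) (a + x * b) (- d) (c + x * d)"
    by (simp add: assms(1))
  have "W ** span_matrix A W a b c d = span_matrix A W
      ((z - x * y) * b - det W * c - x * det W * d) (y * b + det W * d)
      (a + x * b + y * c + z * d) (- b)"
    by (simp add: x_def y_def z_def span_matrix_def matrix2_simps algebra_simps)
  then show "W ** span_matrix A W a b c d =
      span_matrix A W ((z - x * y) * b - c - x * d) (y * b + d) (a + x * b + y * c + z * d) (- b)"
    by (simp add: assms(2))
qed

text \<open>With \<open>t\<close> the trace of \<open>M\<close>, the factor \<open>mat t - M\<close>
  is the inverse letter, so its action on coordinates follows by linearity from that of
  \<open>M\<close>.\<close>

lemma inverse_mult_span_matrix:
  assumes "M ** span_matrix A W a b c d = span_matrix A W a' b' c' d'"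
  shows "(mat t - M) ** span_matrix A W a b c d =
    span_matrix A W (t * a - a') (t * b - b') (t * c - c') (t * d - d')"
proof -
  have "(mat t - M) ** N = mat t ** N - M ** N" for N :: "complex^2^2"
    by (simp add: matrix2_simps algebra_simps)
  then have "(mat t - M) ** span_matrix A W a b c d =
      mat t ** span_matrix A W a b c d - span_matrix A W a' b' c' d'"
    by (simp only: assms)
  also have "\<dots> = span_matrix A W (t * a - a') (t * b - b') (t * c - c') (t * d - d')"
    by (simp add: span_matrix_def matrix2_simps algebra_simps)
  finally show ?thesis .
qed

fun combination ::
    "complex^2^2 \<Rightarrow> complex^2^2 \<Rightarrow> poly3 \<times> poly3 \<times> poly3 \<times> poly3 \<Rightarrow> complex^2^2" where
  "combination A W (a, b, c, d) =
     (let ev = (\<lambda>p. eval3 p (trace A) (trace W) (trace (A ** W)))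
      in span_matrix A W (ev a) (ev b) (ev c) (ev d))"

lemma letter_action_combination:
  assumes "det A = 1" "det W = 1"
  shows "letter_matrix A W l ** combination A W q = combination A W (letter_action l q)"
proof -
  obtain a b c d where q: "q = (a, b, c, d)" by (cases q)
  obtain g e where l: "l = (g, e)" by (cases l)
  note * = mult_span_matrix[OF assms]
  show ?thesis
    unfolding q l
    by (cases g; cases e)
      (simp_all add: Let_def * *[THEN inverse_mult_span_matrix] algebra_simps)
qed

lemma word_matrix_eq_combination:
  assumes "det A = 1" "det W = 1"
  shows "word_matrix A W u = combination A W (word_coords u)"
proof (induction u)
  case Nil
  show ?case by (simp add: Let_def span_matrix_def matrix2_simps)
next
  case (Cons l u)
  then show ?case by (simp add: letter_action_combination[OF assms])
qed

section \<open>Trace polynomials\<close>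

definition coords_trace :: "poly3 \<times> poly3 \<times> poly3 \<times> poly3 \<Rightarrow> poly3" where
  "coords_trace = (\<lambda>(a, b, c, d). 2 * a + b * X3 + c * Y3 + d * Z3)"

lemma trace_combination:
  "trace (combination A W q) = eval3 (coords_trace q) (trace A) (trace W) (trace (A ** W))"
proof -
  have "eval3 2 x y z = 2" for x y z
    using eval3_simps(3)[of 1 1 x y z] by simp
  then show ?thesis
    by (cases q) (simp add: coords_trace_def Let_def span_matrix_def matrix2_simps algebra_simps)
qed

text \<open>Existence comes from the coordinates, as \<open>1\<close>, \<open>A\<close>,
  \<open>W\<close>, \<open>AW\<close> have traces 2, x, y, z; uniqueness holds because all points of
  complex 3-space occur as traces.\<close>

lemma trace_poly_word_class: "trace_poly (word_class u) = coords_trace (word_coords u)"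
proof -
  have aw: "gen_a \<otimes>\<^bsub>free_group\<^esub> gen_w = word_class [(GenA, True), (GenW, True)]"
    by (simp add: gen_a_def gen_w_def mult_word_class)
  have aw_hom: "\<rho> (gen_a \<otimes>\<^bsub>free_group\<^esub> gen_w) = \<rho> gen_a ** \<rho> gen_w"
    if "\<rho> \<in> hom free_group SL2C" for \<rho>
    by (simp add: aw hom_free_group_SL2C(3)[OF that])
  show ?thesis
    unfolding trace_poly_def
  proof (rule the_equality)
    show "\<forall>\<rho>\<in>hom free_group SL2C. trace (\<rho> (word_class u)) =
        eval3 (coords_trace (word_coords u)) (trace (\<rho> gen_a)) (trace (\<rho> gen_w))
          (trace (\<rho> (gen_a \<otimes>\<^bsub>free_group\<^esub> gen_w)))"
      by (simp add: aw_hom hom_free_group_SL2C word_matrix_eq_combination trace_combination)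
  next
    fix p
    assume p: "\<forall>\<rho>\<in>hom free_group SL2C. trace (\<rho> (word_class u)) =
        eval3 p (trace (\<rho> gen_a)) (trace (\<rho> gen_w)) (trace (\<rho> (gen_a \<otimes>\<^bsub>free_group\<^esub> gen_w)))"
    show "p = coords_trace (word_coords u)"
    proof (rule eval3_eqI)
      fix x y z
      obtain A W :: "complex^2^2" where AW: "det A = 1" "det W = 1"
        and tr: "trace A = x" "trace W = y" "trace (A ** W) = z"
        by (rule SL2_with_traces)
      have gens: "rep A W gen_a = A" "rep A W gen_w = W"
        by (simp_all add: gen_a_def gen_w_def rep_word_class[OF AW])
      show "eval3 p x y z = eval3 (coords_trace (word_coords u)) x y z"
        using bspec[OF p rep_hom[OF AW]]
        by (simp add: aw_hom[OF rep_hom[OF AW]] gens tr rep_word_class[OF AW]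
            word_matrix_eq_combination[OF AW] trace_combination)
    qed
  qed
qed

lemma eval3_trace_poly:
  assumes "det A = 1" "det W = 1"
  shows "eval3 (trace_poly (word_class u)) (trace A) (trace W) (trace (A ** W)) =
    trace (word_matrix A W u)"
  by (simp add: trace_poly_word_class word_matrix_eq_combination[OF assms] trace_combination)

lemma trace_poly_comm:
  "trace_poly (word_class (u @ v)) = trace_poly (word_class (v @ u))"
proof (rule eval3_eqI)
  fix x y z
  obtain A W :: "complex^2^2" where AW: "det A = 1" "det W = 1"
    and tr: "trace A = x" "trace W = y" "trace (A ** W) = z"
    by (rule SL2_with_traces)
  show "eval3 (trace_poly (word_class (u @ v))) x y z = eval3 (trace_poly (word_class (v @ u))) x y z"
    using eval3_trace_poly[OF AW, of "u @ v"] eval3_trace_poly[OF AW, of "v @ u"]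
      trace_mul_sym[of "word_matrix A W u" "word_matrix A W v"]
    by (simp add: tr word_matrix_append)
qed

section \<open>Reversal of words and the additive commutator \<open>AW - WA\<close>\<close>

definition aw_coord :: "word \<Rightarrow> poly3" where
  "aw_coord u = snd (snd (snd (word_coords u)))"

text \<open>Transposing the generators leaves all coordinates unchanged, so \<open>\<rho>(rev u)\<close> has the
  coordinates of \<open>\<rho>(u)\<close> with respect to \<open>1, A, W, WA\<close>.\<close>

lemma word_matrix_minus_rev:
  assumes "det A = 1" "det W = 1"
  defines "x \<equiv> trace A" and "y \<equiv> trace W" and "z \<equiv> trace (A ** W)"
  shows "word_matrix A W u - word_matrix A W (rev u) =
    mat (eval3 (aw_coord u) x y z) ** (A ** W - W ** A)"
proof -
  obtain a b c d where q: "word_coords u = (a, b, c, d)" by (cases "word_coords u")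
  have T: "det (transpose A) = 1" "det (transpose W) = 1"
    using assms by simp_all
  \<comment> \<open>The coordinate polynomials are thus evaluated at the same point for the
    transposed pair.\<close>
  have tr: "trace (transpose A) = x" "trace (transpose W) = y"
    "trace (transpose A ** transpose W) = z"
    by (simp_all add: assms matrix2_simps algebra_simps)
  have "word_matrix A W (rev u) = transpose (word_matrix (transpose A) (transpose W) u)"
    using word_matrix_transpose[of "transpose A" "transpose W" u] by simp
  then show ?thesis
    using assms
    by (simp add: word_matrix_eq_combination T q tr aw_coord_def Let_def)
      (simp add: span_matrix_def matrix2_simps algebra_simps)
qed

text \<open>Cyclicity of the trace kills the contributions of \<open>1\<close>, \<open>A\<close> and
  \<open>W\<close>, so only the \<open>AW\<close> coordinate survives.\<close>

lemma trace_mult_commutator: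
  assumes "det A = 1" "det W = 1"
  shows "trace (word_matrix A W u ** (A ** W - W ** A)) =
    eval3 (aw_coord u) (trace A) (trace W) (trace (A ** W)) *
      trace (A ** W ** (A ** W - W ** A))"
proof -
  obtain a b c d where q: "word_coords u = (a, b, c, d)" by (cases "word_coords u")
  show ?thesis
    by (simp add: word_matrix_eq_combination[OF assms] q aw_coord_def Let_def)
      (simp add: span_matrix_def matrix2_simps algebra_simps)
qed

lemma trace_poly_minus_rev:
  "trace_poly (word_class (v @ r)) - trace_poly (word_class (v @ rev r)) =
   aw_coord v * (trace_poly (word_class (r @ [(GenA, True), (GenW, True)])) -
     trace_poly (word_class (rev r @ [(GenA, True), (GenW, True)])))"
proof (rule eval3_eqI)
  fix x y z
  obtain A W :: "complex^2^2" where AW: "det A = 1" "det W = 1"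
    and tr: "trace A = x" "trace W = y" "trace (A ** W) = z"
    by (rule SL2_with_traces)
  have ev: "eval3 (trace_poly (word_class u)) x y z = trace (word_matrix A W u)" for u
    using eval3_trace_poly[OF AW] by (simp add: tr)
  \<comment> \<open>Only the factor \<open>aw_coord u\<close> depends on \<open>u\<close>, so the
    case \<open>u = v\<close> is a multiple of the case \<open>u = aw\<close>, whose coordinate is
    1.\<close>
  have diff: "trace (word_matrix A W (u @ r)) - trace (word_matrix A W (u @ rev r)) =
      eval3 (aw_coord r) x y z * (eval3 (aw_coord u) x y z * trace (A ** W ** (A ** W - W ** A)))"
    for u
  proof -
    let ?M = "word_matrix A W"
    have "trace (?M (u @ r)) - trace (?M (u @ rev r)) = trace (?M u ** (?M r - ?M (rev r)))"
      by (simp add: word_matrix_append matrix2_simps algebra_simps)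
    also have "\<dots> = eval3 (aw_coord r) x y z * trace (?M u ** (A ** W - W ** A))"
      unfolding word_matrix_minus_rev[OF AW] tr by (simp add: matrix2_simps algebra_simps)
    finally show ?thesis by (simp add: trace_mult_commutator[OF AW] tr)
  qed
  have "aw_coord [(GenA, True), (GenW, True)] = 1"
    by (simp add: aw_coord_def)
  then show "eval3 (trace_poly (word_class (v @ r)) - trace_poly (word_class (v @ rev r))) x y z =
    eval3 (aw_coord v * (trace_poly (word_class (r @ [(GenA, True), (GenW, True)])) -
     trace_poly (word_class (rev r @ [(GenA, True), (GenW, True)])))) x y z"
    using diff[of v] diff[of "[(GenA, True), (GenW, True)]"]
    \<comment> \<open>Cyclicity moves \<open>aw\<close> to the left of \<open>r\<close> and
      \<open>rev r\<close>, where \<open>diff\<close> applies.\<close>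
    unfolding trace_poly_comm[of _ "[(GenA, True), (GenW, True)]"]
    by (simp only: eval3_simps ev) simp
qed

section \<open>The universal character ideal\<close>

lemma PIdl_poly3_ring: "PIdl\<^bsub>poly3_ring\<^esub> d = {p. d dvd p}"
  by (auto simp: cgenideal_def poly3_ring_def dvd_def mult.commute)

lemma trace_poly_comm_group:
  assumes "S \<in> carrier free_group" "T \<in> carrier free_group"
  shows "trace_poly (S \<otimes>\<^bsub>free_group\<^esub> T) = trace_poly (T \<otimes>\<^bsub>free_group\<^esub> S)"
  using assms by (auto simp: carrier_free_group mult_word_class trace_poly_comm)

lemma normal_trace_kernel:
  "{u \<in> carrier free_group. \<forall>v\<in>carrier free_group.
      d dvd trace_poly (v \<otimes>\<^bsub>free_group\<^esub> u) - trace_poly v} \<lhd> free_group"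
  (is "?N \<lhd> _")
proof -
  interpret F: group free_group by (rule group_free_group)
  let ?m = "\<lambda>u v. u \<otimes>\<^bsub>free_group\<^esub> v" and ?i = "\<lambda>u. inv\<^bsub>free_group\<^esub> u"
  have "subgroup ?N free_group"
  proof (rule F.subgroupI)
    show "?N \<noteq> {}"
    proof -
      have "\<one>\<^bsub>free_group\<^esub> \<in> ?N" by simp
      then show ?thesis by blast
    qed
  next
    fix u assume u: "u \<in> ?N"
    have "d dvd trace_poly (?m v (?i u)) - trace_poly v" if v: "v \<in> carrier free_group" for v
    proof -
      \<comment> \<open>The condition on \<open>u\<close> is taken at the shifted element
        \<open>?m v (?i u)\<close>; it gives the wanted difference up to sign.\<close>
      have "d dvd trace_poly (?m (?m v (?i u)) u) - trace_poly (?m v (?i u))"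
        using u v by blast
      then show ?thesis
        using u v dvd_minus_iff[of d "trace_poly v - trace_poly (?m v (?i u))"]
        by (simp add: F.m_assoc)
    qed
    then show "?i u \<in> ?N" using u by simp
  next
    fix u u' assume u: "u \<in> ?N" "u' \<in> ?N"
    have "d dvd trace_poly (?m v (?m u u')) - trace_poly v" if v: "v \<in> carrier free_group" for v
    proof -
      have "d dvd (trace_poly (?m (?m v u) u') - trace_poly (?m v u)) +
          (trace_poly (?m v u) - trace_poly v)"
        using u v by (intro dvd_add) auto
      then show ?thesis using u v by (simp add: F.m_assoc)
    qed
    then show "?m u u' \<in> ?N" using u by simp
  qed auto
  moreover have "?m (?m g u) (?i g) \<in> ?N" if g: "g \<in> carrier free_group" and u: "u \<in> ?N" for g u
  proof -
    have "d dvd trace_poly (?m v (?m (?m g u) (?i g))) - trace_poly v"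
      if v: "v \<in> carrier free_group" for v
    proof -
      \<comment> \<open>The condition on \<open>u\<close> at the conjugate of \<open>v\<close> by
        \<open>g\<close>; cyclicity then carries the conjugation over to \<open>u\<close>.\<close>
      have "d dvd trace_poly (?m (?m (?i g) (?m v g)) u) - trace_poly (?m (?i g) (?m v g))"
        using g u v by auto
      also have "trace_poly (?m (?i g) (?m v g)) = trace_poly v"
        using g v by (subst trace_poly_comm_group) (auto simp: F.m_assoc)
      also have "?m (?m (?i g) (?m v g)) u = ?m (?i g) (?m (?m v g) u)"
        using g u v by (simp add: F.m_assoc)
      also have "trace_poly \<dots> = trace_poly (?m v (?m (?m g u) (?i g)))"
        using g u v by (subst trace_poly_comm_group) (auto simp: F.m_assoc)
      finally show ?thesis .
    qed
    then show ?thesis using g u by simp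
  qed
  ultimately show ?thesis by (simp add: F.normal_inv_iff)
qed

text \<open>Reduces divisibility for all pairs with equal image to the defining relations: the
  normal subgroup \<open>?N\<close> contains every \<open>?m l (?i t)\<close>, hence the normal
  closure.\<close>

lemma trace_poly_presentation:
  assumes E: "E \<subseteq> carrier free_group \<times> carrier free_group"
    and d: "\<And>l t v. (l, t) \<in> E \<Longrightarrow> v \<in> carrier free_group \<Longrightarrow>
      d dvd trace_poly (v \<otimes>\<^bsub>free_group\<^esub> l) - trace_poly (v \<otimes>\<^bsub>free_group\<^esub> t)"
    and u: "u \<in> carrier free_group" and v: "v \<in> carrier free_group"
    and eq: "presentation_map E u = presentation_map E v"
  shows "d dvd trace_poly u - trace_poly v"
proof -
  interpret F: group free_group by (rule group_free_group)
  let ?m = "\<lambda>u v. u \<otimes>\<^bsub>free_group\<^esub> v" and ?i = "\<lambda>u. inv\<^bsub>free_group\<^esub> u"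
  let ?N = "{u \<in> carrier free_group. \<forall>v\<in>carrier free_group. d dvd trace_poly (?m v u) - trace_poly v}"
  have "?m l (?i t) \<in> ?N" if lt: "(l, t) \<in> E" for l t
  proof -
    have carr: "l \<in> carrier free_group" "t \<in> carrier free_group" using E lt by auto
    have "d dvd trace_poly (?m v (?m l (?i t))) - trace_poly v" if v: "v \<in> carrier free_group" for v
    proof -
      \<comment> \<open>Left multiplication by \<open>?i t\<close> turns, after a cyclic shift, into
        right multiplication by it, which cancels \<open>t\<close>.\<close>
      have "d dvd trace_poly (?m (?m (?i t) v) l) - trace_poly (?m (?m (?i t) v) t)"
        using d[OF lt] carr v by simp
      also have "?m (?m (?i t) v) l = ?m (?i t) (?m v l)"
        using carr v by (simp add: F.m_assoc)
      also have "trace_poly \<dots> = trace_poly (?m v (?m l (?i t)))"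
        using carr v by (subst trace_poly_comm_group) (auto simp: F.m_assoc)
      also have "trace_poly (?m (?m (?i t) v) t) = trace_poly v"
        using carr v by (subst trace_poly_comm_group) (auto simp: F.m_assoc[symmetric])
      finally show ?thesis .
    qed
    then show ?thesis using carr by simp
  qed
  then have sub: "relation_closure E \<subseteq> ?N"
    unfolding relation_closure_def using normal_trace_kernel[of d] by blast
  interpret H: normal "relation_closure E" free_group
    by (rule normal_relation_closure[OF E])
  have "u \<in> relation_closure E #>\<^bsub>free_group\<^esub> v"
    using eq F.rcos_self[OF u H.subgroup_axioms] by (simp add: presentation_map_def)
  then obtain h where h: "h \<in> relation_closure E" "u = ?m h v"
    by (auto simp: r_coset_def)
  then have "h \<in> ?N" using sub by blast
  \<comment> \<open>Membership in \<open>?N\<close> controls \<open>?m v h\<close>, and cyclicity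
    replaces it by \<open>?m h v\<close>, which is \<open>u\<close>.\<close>
  then show ?thesis
    using v h(2) trace_poly_comm_group[of h v] by auto
qed

text \<open>Shows that relations remain valid after right multiplication, which makes
  \<open>d\<close> a generator of the universal character ideal.\<close>

lemma presentation_map_relation:
  assumes E: "E \<subseteq> carrier free_group \<times> carrier free_group" and lt: "(l, t) \<in> E"
    and v: "v \<in> carrier free_group"
  shows "presentation_map E (l \<otimes>\<^bsub>free_group\<^esub> v) = presentation_map E (t \<otimes>\<^bsub>free_group\<^esub> v)"
proof -
  interpret H: normal "relation_closure E" free_group
    by (rule normal_relation_closure[OF E])
  have carr: "l \<in> carrier free_group" "t \<in> carrier free_group" using E lt by auto
  have "l \<otimes>\<^bsub>free_group\<^esub> inv\<^bsub>free_group\<^esub> t \<in> relation_closure E"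
    using lt unfolding relation_closure_def by auto
  moreover have "l \<otimes>\<^bsub>free_group\<^esub> v =
      (l \<otimes>\<^bsub>free_group\<^esub> inv\<^bsub>free_group\<^esub> t) \<otimes>\<^bsub>free_group\<^esub> (t \<otimes>\<^bsub>free_group\<^esub> v)"
  proof -
    have "inv\<^bsub>free_group\<^esub> t \<otimes>\<^bsub>free_group\<^esub> (t \<otimes>\<^bsub>free_group\<^esub> v) = v"
      using carr v by (simp add: H.m_assoc[symmetric])
    then show ?thesis using carr v by (simp add: H.m_assoc)
  qed
  ultimately have "l \<otimes>\<^bsub>free_group\<^esub> v \<in> relation_closure E #>\<^bsub>free_group\<^esub> (t \<otimes>\<^bsub>free_group\<^esub> v)"
    unfolding r_coset_def by blast
  then show ?thesis
    unfolding presentation_map_def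
    using H.repr_independence[OF _ _ H.subgroup_axioms] carr v by (metis H.m_closed)
qed

theorem theorem1:
  fixes r :: word
  shows "universal_character_ring
           (presentation_map {(word_class r, word_class (rev r))}) =
         poly3_ring Quot
           (PIdl\<^bsub>poly3_ring\<^esub>
              (trace_poly (word_class r \<otimes>\<^bsub>free_group\<^esub> gen_a \<otimes>\<^bsub>free_group\<^esub> gen_w) -
               trace_poly (word_class (rev r) \<otimes>\<^bsub>free_group\<^esub> gen_a \<otimes>\<^bsub>free_group\<^esub> gen_w)))"
proof -
  interpret R: cring poly3_ring by (rule cring_poly3_ring)
  let ?E = "{(word_class r, word_class (rev r))}"
  define aw where "aw = [(GenA, True), (GenW, True)]"
  define d where "d = trace_poly (word_class (r @ aw)) - trace_poly (word_class (rev r @ aw))"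
  let ?S = "{trace_poly u - trace_poly v | u v. u \<in> carrier free_group \<and> v \<in> carrier free_group \<and>
      presentation_map ?E u = presentation_map ?E v}"
  have UNIV: "carrier poly3_ring = UNIV" by (simp add: poly3_ring_def)
  have E: "?E \<subseteq> carrier free_group \<times> carrier free_group" by (auto simp: carrier_free_group)
  have "presentation_map ?E (word_class (r @ aw)) = presentation_map ?E (word_class (rev r @ aw))"
    using presentation_map_relation[OF E, of "word_class r" "word_class (rev r)" "word_class aw"]
    by (simp add: carrier_free_group mult_word_class)
  then have "d \<in> ?S" unfolding d_def carrier_free_group by blast
  then have "d \<in> Idl\<^bsub>poly3_ring\<^esub> ?S"
    using R.genideal_self[of ?S] by (auto simp: UNIV)
  then have ge: "PIdl\<^bsub>poly3_ring\<^esub> d \<subseteq> Idl\<^bsub>poly3_ring\<^esub> ?S"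
    by (intro R.cgenideal_minimal R.genideal_ideal) (simp add: UNIV)
  \<comment> \<open>The quotient is \<open>aw_coord\<close> of a word representing
    \<open>v\<close>.\<close>
  have dvd: "d dvd trace_poly (v \<otimes>\<^bsub>free_group\<^esub> l) - trace_poly (v \<otimes>\<^bsub>free_group\<^esub> t)"
    if "(l, t) \<in> ?E" "v \<in> carrier free_group" for l t v
    using that trace_poly_minus_rev[of _ r]
    by (auto simp: carrier_free_group mult_word_class d_def aw_def)
  have "?S \<subseteq> PIdl\<^bsub>poly3_ring\<^esub> d"
    using trace_poly_presentation[OF E dvd] by (auto simp: PIdl_poly3_ring)
  moreover have "ideal (PIdl\<^bsub>poly3_ring\<^esub> d) poly3_ring"
    by (intro R.cgenideal_ideal) (simp add: UNIV)
  ultimately have le: "Idl\<^bsub>poly3_ring\<^esub> ?S \<subseteq> PIdl\<^bsub>poly3_ring\<^esub> d"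
    by (intro R.genideal_minimal)
  show ?thesis
    using ge le
    by (simp add: universal_character_ring_def universal_character_ideal_def d_def aw_def
        gen_a_def gen_w_def mult_word_class)
qed

end
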